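(* Let $f:\{0,1\}^n\to\mathbb{R}$, $f(x):=\sum_{k\in[K]}a_k\prod_{j\in A_k}x_j$, be a multilinear function with $a_k\in\mathbb{R}$ and nonempty $A_k\subseteq[n]$, and write $f=f_1-f_2$ with $$f_1(x):=\sum_{k\in[K],\,a_k<0}a_k\prod_{j\in A_k}x_j,\qquad f_2(x):=\sum_{k\in[K],\,a_k>0}-a_k\prod_{j\in A_k}x_j .$$ Let $\ell\in\{0,1\}$, and let $$\mathcal{S}:=\{(x,t)\in\{0,1\}^n\times\mathbb{R}: f_1(x)-f_2(x)\ge\ell t\},\qquad \bar{\mathcal{S}}:=\{(x,t)\in\mathbb{R}^n\times\mathbb{R}:\mathsf F_1(x)-\mathsf F_2(x)\ge\ell t\},$$ where $\mathsf F_1,\mathsf F_2$ are the extended envelopes of $f_1,f_2$. Let $(\tilde x,\tilde t)\in\mathbb{R}^n\times\mathbb{R}$ be a (relaxation) point with $(\tilde x,\tilde t)\notin\mathcal{S}$, let $\gamma^*\in\partial\mathsf F_2(\tilde x)$ be an optimal solution of $\max_{s\in\mathrm{ext}(EPM_{f_2})}s\tilde x$, and let $\mathcal{C}_{\tilde x}:=\{(x,t)\in\mathbb{R}^n\times\mathbb{R}:\mathsf F_1(x)-\gamma^*x\le\ell t\}$. Then $\mathcal{C}_{\tilde x}$ is an $\mathcal{S}$-free set. Moreover, if $(\tilde x,\tilde t)\notin\bar{\mathcal{S}}$, then $\mathcal{C}_{\tilde x}$ contains $(\tilde x,\tilde t)$ in its interior.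
   Context: $[n]=\{1,\dots,n\}$, $[K]=\{1,\dots,K\}$. The product $sx$ of two vectors is the inner product. For $g:\{0,1\}^n\to\mathbb{R}$ with $g(\mathbf 0)=0$ that is submodular (i.e. $g(x)+g(y)\ge g(x\vee y)+g(x\wedge y)$ for all $x,y\in\{0,1\}^n$, componentwise max and min), the extended polymatroid is $EPM_g:=\{s\in\mathbb{R}^n: sx\le g(x)\ \forall x\in\{0,1\}^n\}$, with vertex set $\mathrm{ext}(EPM_g)$, and the extended envelope of $g$ is the convex function $\mathsf G:\mathbb{R}^n\to\mathbb{R}$, $\mathsf G(x):=\max_{s\in\mathrm{ext}(EPM_g)}sx$. The functions $f_1,f_2$ of the claim are submodular on $\{0,1\}^n$. $\partial$ denotes the convex subdifferential. A closed convex set $\mathcal{C}$ is $\mathcal{S}$-free if $\mathrm{int}(\mathcal{C})\cap\mathcal{S}=\varnothing$.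
   Formalization: For ℓ=0 the S-freeness of C is proved only when F_1(z) − γ*z < 0 for some z; without this it can fail (f = x_1 − x_1x_2, x̃ = (1/2, 3/5)). For ℓ=1, and in the "moreover" part, nothing is added. *)

theory Defs
  imports "HOL-Analysis.Analysis"
begin

definition binary_vectors :: "(real ^ 'n) set" where
  "binary_vectors = {x. \<forall>i. x $ i = 0 \<or> x $ i = 1}"

(* A set function g on {0,1}^n is represented by a function on real ^ 'n of which only the
   values on binary_vectors are used. The notions below are meant for submodular g with g 0 = 0. *)

definition EPM :: "(real ^ 'n \<Rightarrow> real) \<Rightarrow> (real ^ 'n) set" where
  "EPM g = {s. \<forall>x\<in>binary_vectors. s \<bullet> x \<le> g x}"

definition ext :: "(real ^ 'n) set \<Rightarrow> (real ^ 'n) set" where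
  "ext P = {s. s extreme_point_of P}"

lemma finite_binary_vectors: "finite (binary_vectors :: (real ^ 'n) set)"
proof -
  have "(binary_vectors :: (real ^ 'n) set) \<subseteq> range (\<lambda>B :: 'n set. \<chi> i. if i \<in> B then 1 else 0)"
  proof
    fix x :: "real ^ 'n"
    assume "x \<in> binary_vectors"
    then have "x = (\<chi> i. if i \<in> {j. x $ j = 1} then 1 else 0)"
      by (auto simp: vec_eq_iff binary_vectors_def)
    then show "x \<in> range (\<lambda>B :: 'n set. \<chi> i. if i \<in> B then 1 else 0)"
      by blast
  qed
  then show ?thesis
    by (rule finite_subset) simp
qed

lemma polyhedron_EPM: "polyhedron (EPM g)"
proof -
  have "EPM g = \<Inter> ((\<lambda>x. {s. x \<bullet> s \<le> g x}) ` binary_vectors)"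
    by (auto simp: EPM_def inner_commute)
  then show ?thesis
    by (auto intro!: polyhedron_Inter finite_imageI
        simp: finite_binary_vectors polyhedron_halfspace_le)
qed

lemma finite_ext_EPM: "finite (ext (EPM g))"
  unfolding ext_def by (intro finite_polyhedron_extreme_points polyhedron_EPM)

definition extended_envelope :: "(real ^ 'n \<Rightarrow> real) \<Rightarrow> real ^ 'n \<Rightarrow> real" where
  "extended_envelope g x = Max ((\<lambda>s. s \<bullet> x) ` ext (EPM g))"

definition subdifferential :: "('a::real_inner \<Rightarrow> real) \<Rightarrow> 'a \<Rightarrow> 'a set" where
  "subdifferential F x = {s. \<forall>y. F y \<ge> F x + s \<bullet> (y - x)}"

definition free_set :: "'a::real_normed_vector set \<Rightarrow> 'a set \<Rightarrow> bool" where
  "free_set S C \<longleftrightarrow> closed C \<and> convex C \<and> interior C \<inter> S = {}"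

end

theory Submission
  imports Defs
begin

text \<open>
  Why the theorem holds.  Every vertex \<open>s\<close> of the extended polymatroid of \<open>f1\<close> contributes one
  linear inequality, so \<open>C\<close> is the cone cut out by the finitely many homogeneous halfspaces
  \<open>(s - \<gamma>) \<bullet> x - l * t \<le> 0\<close>.  Closedness and convexity are then immediate.  Whenever \<open>C\<close> has a
  Slater point (for \<open>l = 1\<close> the point \<open>(0, 1)\<close> always is one, for \<open>l = 0\<close> it is assumed), none of the
  normals \<open>(s - \<gamma>, - l)\<close> vanishes, so all these inequalities are strict in the interior of \<open>C\<close>.

  Freeness is now a matter of picking, for a binary point \<open>x\<close>, a vertex \<open>s\<close> with \<open>s \<bullet> x = f1 x\<close>:
  since \<open>\<gamma>\<close> lies in the extended polymatroid of \<open>f2\<close>, a point \<open>(x, t)\<close> of \<open>S\<close> satisfies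
  \<open>(s - \<gamma>) \<bullet> x \<ge> f1 x - f2 x \<ge> l * t\<close>, which the strict inequality for \<open>s\<close> excludes.  The
  existence of such a vertex (\<open>tight_vertex_exists\<close>) is the substantial step.  It is Edmonds' greedy
  construction, which becomes elementary for monomials with nonpositive coefficients: rank the
  coordinates, putting the support of \<open>x\<close> first, and charge each coefficient to the last coordinate
  of its monomial.

  For the second claim, optimality of \<open>\<gamma>\<close> gives \<open>extended_envelope f2 xt = \<gamma> \<bullet> xt\<close>, so a point outside
  \<open>Sbar\<close> satisfies all the defining inequalities of \<open>C\<close> strictly, and the strict system is open.
\<close>

section \<open>The extended envelope as a finite maximum\<close>

lemma extended_envelope_le_iff:
  assumes "ext (EPM g) \<noteq> {}"
  shows "extended_envelope g x \<le> c \<longleftrightarrow> (\<forall>s\<in>ext (EPM g). s \<bullet> x \<le> c)"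
  using assms by (simp add: extended_envelope_def finite_ext_EPM)

lemma extended_envelope_less_iff:
  assumes "ext (EPM g) \<noteq> {}"
  shows "extended_envelope g x < c \<longleftrightarrow> (\<forall>s\<in>ext (EPM g). s \<bullet> x < c)"
  using assms by (simp add: extended_envelope_def finite_ext_EPM)

lemma extended_envelope_eq_arg_max:
  assumes "is_arg_max (\<lambda>s. s \<bullet> x) (\<lambda>s. s \<in> ext (EPM g)) \<gamma>"
  shows "extended_envelope g x = \<gamma> \<bullet> x"
  unfolding extended_envelope_def
  using assms by (intro Max_eqI) (auto simp: is_arg_max_def finite_ext_EPM not_less)

section \<open>Greedy vertices of the extended polymatroid\<close>

text \<open>
  The prefixes of the order that \<open>r\<close> induces on the coordinates, as binary vectors.
\<close>

definition prefix_vector :: "('n \<Rightarrow> nat) \<Rightarrow> nat \<Rightarrow> real ^ 'n" where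
  "prefix_vector r c = (\<chi> j. if r j < c then 1 else 0)"

lemma prefix_vector_binary: "prefix_vector r c \<in> binary_vectors"
  by (simp add: prefix_vector_def binary_vectors_def)

text \<open>
  Two consecutive prefixes differ by one coordinate when the ranks are distinct; hence a vector is
  determined by its inner products with all prefixes.
\<close>

lemma axis_eq_prefix_vector_diff:
  assumes "inj r"
  shows "axis i 1 = prefix_vector r (Suc (r i)) - prefix_vector r (r i)"
  using assms by (auto simp: vec_eq_iff prefix_vector_def axis_def inj_def less_Suc_eq)

text \<open>
  If \<open>s\<close> lay between two points of the polymatroid, both would be tight wherever \<open>s\<close> is; tightness on
  all prefixes then forces them to coincide.
\<close>

lemma extreme_point_of_EPM_if_tight_on_prefixes:
  assumes s: "s \<in> EPM g" and r: "inj r"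
    and tight: "\<And>c. s \<bullet> prefix_vector r c = g (prefix_vector r c)"
  shows "s extreme_point_of EPM g"
proof -
  have "s \<notin> open_segment u v" if uv: "u \<in> EPM g" "v \<in> EPM g" for u v
  proof
    assume "s \<in> open_segment u v"
    then obtain q where "u \<noteq> v" and q: "0 < q" "q < 1" and s_eq: "s = (1 - q) *\<^sub>R u + q *\<^sub>R v"
      by (auto simp: in_segment)
    have "u \<bullet> prefix_vector r c = v \<bullet> prefix_vector r c" for c
    proof -
      let ?p = "prefix_vector r c"
      have le: "u \<bullet> ?p \<le> g ?p" "v \<bullet> ?p \<le> g ?p"
        using uv prefix_vector_binary by (auto simp: EPM_def)
      \<comment> \<open>the slack of \<open>s\<close> is zero and averages the nonnegative slacks of \<open>u\<close> and \<open>v\<close>\<close>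
      have "(1 - q) * (g ?p - u \<bullet> ?p) + q * (g ?p - v \<bullet> ?p) = 0"
        using tight[of c] by (simp add: s_eq inner_add_left algebra_simps)
      moreover have "0 \<le> (1 - q) * (g ?p - u \<bullet> ?p)" "0 \<le> q * (g ?p - v \<bullet> ?p)"
        using le q by simp_all
      ultimately have "(1 - q) * (g ?p - u \<bullet> ?p) = 0" "q * (g ?p - v \<bullet> ?p) = 0"
        by linarith+
      with q show ?thesis by simp
    qed
    then have "u \<bullet> axis i 1 = v \<bullet> axis i 1" for i
      by (simp add: axis_eq_prefix_vector_diff[OF r] inner_diff_right)
    then have "u = v"
      by (simp add: vec_eq_iff inner_axis)
    with \<open>u \<noteq> v\<close> show False ..
  qed
  with s show ?thesis by (simp add: extreme_point_of_def)
qed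

lemma prod_binary_le:
  assumes "x \<in> binary_vectors" and "j \<in> A"
  shows "(\<Prod>i\<in>A. x $ i) \<le> x $ j"
proof (cases "x $ j = 0")
  case True
  then have "(\<Prod>i\<in>A. x $ i) = 0"
    using assms(2) by (auto intro!: prod_zero)
  with True show ?thesis by (simp only: order_refl)
next
  case False
  then have "x $ j = 1"
    using assms(1) by (auto simp: binary_vectors_def)
  have "0 \<le> x $ i \<and> x $ i \<le> 1" for i
  proof -
    have "x $ i = 0 \<or> x $ i = 1" using assms(1) by (simp add: binary_vectors_def)
    then show ?thesis by fastforce
  qed
  then have "(\<Prod>i\<in>A. x $ i) \<le> 1" by (rule prod_le_1)
  also have "1 = x $ j" using \<open>x $ j = 1\<close> by (rule sym)
  finally show ?thesis .
qed

text \<open>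
  A prefix contains a set as soon as it contains the last element of that set.
\<close>

lemma prod_prefix_vector_eq_last:
  fixes A :: "'n::finite set"
  assumes "j \<in> A" and "\<And>i. i \<in> A \<Longrightarrow> r i \<le> r j"
  shows "(\<Prod>i\<in>A. prefix_vector r c $ i) = prefix_vector r c $ j"
proof (cases "r j < c")
  case True
  then have "prefix_vector r c $ i = 1" if "i \<in> A" for i
    using assms(2)[OF that] by (simp add: prefix_vector_def)
  with assms(1) show ?thesis by simp
next
  case False
  then have "prefix_vector r c $ j = 0" by (simp add: prefix_vector_def)
  moreover from this have "(\<Prod>i\<in>A. prefix_vector r c $ i) = 0"
    using assms(1) by (auto intro!: prod_zero)
  ultimately show ?thesis by simp
qed

text \<open>
  Replacing every monomial by its last variable can only increase the product, so with nonpositive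
  coefficients the resulting linear function stays below \<open>g\<close>; on prefixes nothing is lost.
\<close>

lemma greedy_vertex_exists:
  fixes g :: "real ^ 'n \<Rightarrow> real" and A :: "'k \<Rightarrow> 'n set"
  assumes g: "\<And>x. x \<in> binary_vectors \<Longrightarrow> g x = (\<Sum>k\<in>I. a k * (\<Prod>j\<in>A k. x $ j))"
    and a: "\<And>k. k \<in> I \<Longrightarrow> a k \<le> 0"
    and A: "\<And>k. k \<in> I \<Longrightarrow> A k \<noteq> {}"
    and r: "inj r"
  obtains s where "s extreme_point_of EPM g"
    and "\<And>c. s \<bullet> prefix_vector r c = g (prefix_vector r c)"
proof -
  have "\<exists>j. j \<in> A k \<and> (\<forall>i\<in>A k. r i \<le> r j)" if "k \<in> I" for k
  proof -
    have "Max (r ` A k) \<in> r ` A k"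
      using A[OF that] by (intro Max_in) auto
    then obtain j where "j \<in> A k" "r j = Max (r ` A k)" by auto
    then show ?thesis by (intro exI[of _ j]) simp
  qed
  then obtain last where last: "\<And>k. k \<in> I \<Longrightarrow> last k \<in> A k"
    "\<And>k i. k \<in> I \<Longrightarrow> i \<in> A k \<Longrightarrow> r i \<le> r (last k)"
    by metis
  define s where "s = (\<Sum>k\<in>I. a k *\<^sub>R axis (last k) (1::real))"
  have s_inner: "s \<bullet> x = (\<Sum>k\<in>I. a k * x $ last k)" for x
    by (simp add: s_def inner_sum_left inner_axis')
  have "s \<in> EPM g"
    using last(1) a by (auto simp: EPM_def s_inner g intro!: sum_mono mult_left_mono_neg prod_binary_le)
  moreover have tight: "s \<bullet> prefix_vector r c = g (prefix_vector r c)" for c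
    unfolding s_inner g[OF prefix_vector_binary]
  proof (rule sum.cong[OF refl])
    fix k assume "k \<in> I"
    then show "a k * prefix_vector r c $ last k = a k * (\<Prod>j\<in>A k. prefix_vector r c $ j)"
      using prod_prefix_vector_eq_last[of "last k" "A k" r c] last by metis
  qed
  ultimately have "s extreme_point_of EPM g"
    using r by (intro extreme_point_of_EPM_if_tight_on_prefixes)
  with tight show ?thesis using that by blast
qed

lemma binary_vector_is_prefix_vector:
  fixes x :: "real ^ 'n"
  assumes "x \<in> binary_vectors"
  obtains r :: "'n \<Rightarrow> nat" and c where "inj r" and "x = prefix_vector r c"
proof -
  obtain e :: "'n \<Rightarrow> nat" and N where e: "inj e" "range e = {i. i < N}"
    using finite_imp_inj_to_nat_seg[OF finite_class.finite_UNIV] by metis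
  have e_less: "e i < N" for i
    using e(2) rangeI[of e i] by simp
  \<comment> \<open>shifting the ranks off the support by \<open>N\<close> makes the support the prefix below rank \<open>N\<close>\<close>
  define r where "r i = (if x $ i = 1 then e i else N + e i)" for i
  have "r i < N \<longleftrightarrow> x $ i = 1" for i
    using e_less by (simp add: r_def)
  then have "x = prefix_vector r N"
    using assms by (auto simp: prefix_vector_def vec_eq_iff binary_vectors_def)
  moreover have "inj r"
  proof (rule injI)
    fix i j
    assume "r i = r j"
    then have "e i = e j"
      using e_less[of i] e_less[of j] by (auto simp: r_def split: if_splits)
    with e(1) show "i = j" by (simp add: inj_eq)
  qed
  ultimately show ?thesis using that by blast
qed

lemma tight_vertex_exists:
  fixes g :: "real ^ 'n \<Rightarrow> real" and A :: "'k \<Rightarrow> 'n set"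
  assumes "\<And>x. x \<in> binary_vectors \<Longrightarrow> g x = (\<Sum>k\<in>I. a k * (\<Prod>j\<in>A k. x $ j))"
    and "\<And>k. k \<in> I \<Longrightarrow> a k \<le> 0"
    and "\<And>k. k \<in> I \<Longrightarrow> A k \<noteq> {}"
    and "x \<in> binary_vectors"
  obtains s where "s \<in> ext (EPM g)" and "s \<bullet> x = g x"
proof -
  obtain r c where r: "inj r" and x: "x = prefix_vector r c"
    using binary_vector_is_prefix_vector assms(4) by blast
  obtain s where "s extreme_point_of EPM g" "s \<bullet> prefix_vector r c = g (prefix_vector r c)"
    by (rule greedy_vertex_exists[OF assms(1-3) r]) auto
  with x show ?thesis using that by (simp add: ext_def)
qed

section \<open>Cones cut out by homogeneous halfspaces\<close>

text \<open>
  A point at which one inequality is strict certifies that its normal is nonzero, so that the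
  interior of the halfspace is the open halfspace.
\<close>

lemma interior_Inter_halfspaces_strict:
  fixes p p0 :: "'a::euclidean_space"
  assumes "p \<in> interior (\<Inter>w\<in>W. {q. w \<bullet> q \<le> 0})" and "w \<in> W" and "w \<bullet> p0 < 0"
  shows "w \<bullet> p < 0"
proof -
  have "w \<noteq> 0" using assms(3) by auto
  moreover have "p \<in> interior {q. w \<bullet> q \<le> 0}"
    using assms(1,2) interior_mono[of "\<Inter>w\<in>W. {q. w \<bullet> q \<le> 0}" "{q. w \<bullet> q \<le> 0}"] by blast
  ultimately show ?thesis by simp
qed

lemma strict_in_interior_Inter_halfspaces:
  fixes p :: "'a::real_inner"
  assumes "finite W" and "\<And>w. w \<in> W \<Longrightarrow> w \<bullet> p < 0"
  shows "p \<in> interior (\<Inter>w\<in>W. {q. w \<bullet> q \<le> 0})"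
proof (rule interiorI)
  show "open (\<Inter>w\<in>W. {q. w \<bullet> q < 0})"
    using assms(1) by (auto intro: open_halfspace_lt)
  show "p \<in> (\<Inter>w\<in>W. {q. w \<bullet> q < 0})"
    using assms(2) by simp
  show "(\<Inter>w\<in>W. {q. w \<bullet> q < 0}) \<subseteq> (\<Inter>w\<in>W. {q. w \<bullet> q \<le> 0})"
    by (intro INF_mono') (simp add: Collect_mono less_imp_le)
qed

section \<open>The intersection cut\<close>

theorem corollary5:
  fixes f f1 f2 :: "real ^ 'n \<Rightarrow> real"
    and K :: nat and a :: "nat \<Rightarrow> real" and A :: "nat \<Rightarrow> 'n set"
    and l :: real
    and xt :: "real ^ 'n" and tt :: real and \<gamma> :: "real ^ 'n"
    and S Sbar C :: "((real ^ 'n) \<times> real) set"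
  assumes A_nonempty: "\<And>k. k \<in> {1..K} \<Longrightarrow> A k \<noteq> {}"
    and f: "\<And>x. x \<in> binary_vectors \<Longrightarrow>
              f x = (\<Sum>k\<in>{1..K}. a k * (\<Prod>j\<in>A k. x $ j))"
    and f1: "\<And>x. x \<in> binary_vectors \<Longrightarrow>
              f1 x = (\<Sum>k\<in>{k \<in> {1..K}. a k < 0}. a k * (\<Prod>j\<in>A k. x $ j))"
    and f2: "\<And>x. x \<in> binary_vectors \<Longrightarrow>
              f2 x = (\<Sum>k\<in>{k \<in> {1..K}. a k > 0}. - a k * (\<Prod>j\<in>A k. x $ j))"
    and l: "l \<in> {0, 1}"
    and S: "S = {(x, t). x \<in> binary_vectors \<and> f1 x - f2 x \<ge> l * t}"
    and Sbar: "Sbar = {(x, t). extended_envelope f1 x - extended_envelope f2 x \<ge> l * t}"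
    and not_in_S: "(xt, tt) \<notin> S"
    and \<gamma>_subgradient: "\<gamma> \<in> subdifferential (extended_envelope f2) xt"
    and \<gamma>_optimal: "is_arg_max (\<lambda>s. s \<bullet> xt) (\<lambda>s. s \<in> ext (EPM f2)) \<gamma>"
    and C: "C = {(x, t). extended_envelope f1 x - \<gamma> \<bullet> x \<le> l * t}"
  shows "(l = 1 \<or> (\<exists>z. extended_envelope f1 z - \<gamma> \<bullet> z < 0) \<longrightarrow> free_set S C)
         \<and> ((xt, tt) \<notin> Sbar \<longrightarrow> (xt, tt) \<in> interior C)"
proof (intro conjI impI)
  let ?V = "ext (EPM f1)"
  let ?W = "(\<lambda>s. (s - \<gamma>, - l)) ` ?V"
  have tight: "\<exists>s\<in>?V. s \<bullet> x = f1 x" if "x \<in> binary_vectors" for x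
  proof -
    have "a k \<le> 0" "A k \<noteq> {}" if "k \<in> {k \<in> {1..K}. a k < 0}" for k
      using that A_nonempty by simp_all
    then show ?thesis
      using tight_vertex_exists[OF f1 _ _ that] by blast
  qed
  have "0 \<in> (binary_vectors :: (real ^ 'n) set)"
    by (simp add: binary_vectors_def)
  with tight have V_ne: "?V \<noteq> {}" by blast
  have C_le: "(x, t) \<in> C \<longleftrightarrow> (\<forall>s\<in>?V. (s - \<gamma>) \<bullet> x - l * t \<le> 0)" for x t
    using extended_envelope_le_iff[OF V_ne, of x "\<gamma> \<bullet> x + l * t"]
    by (simp add: C algebra_simps)
  have C_cone: "C = (\<Inter>w\<in>?W. {q. w \<bullet> q \<le> 0})"
    by (auto simp: C_le)
  have strict: "extended_envelope f1 x - \<gamma> \<bullet> x < l * t \<longleftrightarrow> (\<forall>w\<in>?W. w \<bullet> (x, t) < 0)" for x t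
    using extended_envelope_less_iff[OF V_ne, of x "\<gamma> \<bullet> x + l * t"]
    by (simp add: algebra_simps)
  have \<gamma>_EPM: "\<gamma> \<in> EPM f2"
    using \<gamma>_optimal by (simp add: is_arg_max_def ext_def extreme_point_of_def)

  show "free_set S C" if slater: "l = 1 \<or> (\<exists>z. extended_envelope f1 z - \<gamma> \<bullet> z < 0)"
    unfolding free_set_def
  proof (intro conjI)
    show "closed C" "convex C"
      unfolding C_cone by (auto intro!: closed_halfspace_le convex_INT convex_halfspace_le)
    \<comment> \<open>a Slater point of the cone: going up in \<open>t\<close>, or, for \<open>l = 0\<close>, the assumed one\<close>
    obtain p0 where p0: "\<forall>w\<in>?W. w \<bullet> p0 < 0"
    proof (cases "l = 1")
      case True
      then have "\<forall>w\<in>?W. w \<bullet> (0, 1) < 0" by simp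
      then show ?thesis by (rule that)
    next
      case False
      with slater l obtain z where "extended_envelope f1 z - \<gamma> \<bullet> z < l * 0" by auto
      then have "\<forall>w\<in>?W. w \<bullet> (z, 0) < 0" unfolding strict .
      then show ?thesis by (rule that)
    qed
    show "interior C \<inter> S = {}"
    proof (rule ccontr)
      assume "interior C \<inter> S \<noteq> {}"
      then obtain x t where int: "(x, t) \<in> interior C"
        and x: "x \<in> binary_vectors" and t: "l * t \<le> f1 x - f2 x"
        by (auto simp: S)
      obtain s where s: "s \<in> ?V" "s \<bullet> x = f1 x" using tight[OF x] ..
      have "(s - \<gamma>, - l) \<bullet> (x, t) < 0"
        using interior_Inter_halfspaces_strict[OF int[unfolded C_cone]] s(1) p0 by blast
      moreover have "\<gamma> \<bullet> x \<le> f2 x" using \<gamma>_EPM x by (simp add: EPM_def)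
      ultimately show False using s(2) t by (simp add: inner_diff_left)
    qed
  qed

  show "(xt, tt) \<in> interior C" if "(xt, tt) \<notin> Sbar"
  proof -
    have "extended_envelope f1 xt - \<gamma> \<bullet> xt < l * tt"
      using that extended_envelope_eq_arg_max[OF \<gamma>_optimal] by (simp add: Sbar not_le)
    then have "\<forall>w\<in>?W. w \<bullet> (xt, tt) < 0" unfolding strict .
    then show ?thesis
      unfolding C_cone by (intro strict_in_interior_Inter_halfspaces, simp add: finite_ext_EPM, blast)
  qed
qed

end
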